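(* Let $p$ be a prime, $n=p^2$, and let $\Gamma=\Gamma(D_{2n})$ be the intersection graph of $D_{2n}$. Then the second Zagreb index of $\Gamma$ is $M_2(\Gamma)=2p^4+6p^3+\frac{13}{2}p^2+\frac{7}{2}p+1$.
   Context: $D_{2n}=\langle r,s : r^n=s^2=1,\ srs=r^{-1}\rangle$ is the dihedral group of order $2n$. The intersection graph $\Gamma(G)$ of a finite group $G$ has as vertices the proper non-trivial subgroups of $G$, two distinct vertices being adjacent iff their intersection is non-trivial. The second Zagreb index is $M_2(\Gamma)=\sum_{uv\in E(\Gamma)}\deg(u)\deg(v)$. *)

theory Defs
  imports Complex_Main "HOL-Algebra.Group" "HOL-Computational_Algebra.Primes"
begin

section \<open>Groups given by generators and relations\<close>

text \<open>The letter \<open>(g, True)\<close> stands for the generator \<open>g\<close> and \<open>(g, False)\<close> for its formal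
  inverse.  A relation \<open>u = v\<close> is the pair \<open>(u, v)\<close> of words.\<close>

type_synonym 'g word = "('g \<times> bool) list"

inductive word_eq :: "('g word \<times> 'g word) set \<Rightarrow> 'g word \<Rightarrow> 'g word \<Rightarrow> bool"
  for E :: "('g word \<times> 'g word) set" where
  word_refl: "word_eq E u u"
| word_sym: "word_eq E u v \<Longrightarrow> word_eq E v u"
| word_trans: "word_eq E u v \<Longrightarrow> word_eq E v w \<Longrightarrow> word_eq E u w"
| word_append: "word_eq E u u' \<Longrightarrow> word_eq E v v' \<Longrightarrow> word_eq E (u @ v) (u' @ v')"
| word_cancel: "word_eq E [(g, b), (g, \<not> b)] []"
| word_rel: "(u, v) \<in> E \<Longrightarrow> word_eq E u v"

definition word_class :: "('g word \<times> 'g word) set \<Rightarrow> 'g word \<Rightarrow> 'g word set" where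
  "word_class E u = {v. word_eq E u v}"

text \<open>The group with generators all elements of the type \<open>'g\<close> and relations \<open>E\<close>.\<close>

definition presented_group :: "('g word \<times> 'g word) set \<Rightarrow> 'g word set monoid" where
  "presented_group E =
    \<lparr>carrier = range (word_class E),
     monoid.mult = (\<lambda>A B. \<Union>u\<in>A. \<Union>v\<in>B. word_class E (u @ v)),
     monoid.one = word_class E []\<rparr>"

lemma word_class_eq_iff: "word_class E u = word_class E v \<longleftrightarrow> word_eq E u v"
  unfolding word_class_def by (blast intro: word_refl word_sym word_trans)

lemma presented_group_carrier: "carrier (presented_group E) = range (word_class E)"
  by (simp add: presented_group_def)

lemma presented_group_one: "\<one>\<^bsub>presented_group E\<^esub> = word_class E []"
  by (simp add: presented_group_def)

lemma presented_group_mult: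
  "word_class E u \<otimes>\<^bsub>presented_group E\<^esub> word_class E v = word_class E (u @ v)"
proof -
  have *: "word_class E (u' @ v') = word_class E (u @ v)"
    if "u' \<in> word_class E u" "v' \<in> word_class E v" for u' v'
  proof -
    have "word_eq E u u'" "word_eq E v v'"
      using that by (simp_all add: word_class_def)
    then show ?thesis
      unfolding word_class_eq_iff by (rule word_sym[OF word_append])
  qed
  have "u \<in> word_class E u" "v \<in> word_class E v"
    by (simp_all add: word_class_def word_refl)
  then have "(\<Union>u'\<in>word_class E u. \<Union>v'\<in>word_class E v. word_class E (u' @ v'))
      = word_class E (u @ v)"
    using * by blast
  then show ?thesis
    by (simp add: presented_group_def)
qed

lemma word_eq_left_inverse:
  "word_eq E (rev (map (\<lambda>(g, b). (g, \<not> b)) u) @ u) []"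
proof (induction u)
  case Nil
  show ?case by (simp add: word_refl)
next
  case (Cons a u)
  obtain g b where a: "a = (g, b)" by (cases a)
  let ?w = "rev (map (\<lambda>(g, b). (g, \<not> b)) u)"
  have "word_eq E ([(g, \<not> b), (g, b)] @ u) ([] @ u)"
    using word_append[OF word_cancel[of E g "\<not> b"] word_refl[of E u]] by simp
  then have "word_eq E (?w @ [(g, \<not> b), (g, b)] @ u) (?w @ u)"
    using word_append[OF word_refl[of E ?w]] by force
  then have "word_eq E (?w @ [(g, \<not> b), (g, b)] @ u) []"
    using Cons.IH by (rule word_trans)
  then show ?case
    by (simp add: a)
qed

lemma group_presented_group: "group (presented_group E)"
proof (rule groupI, goal_cases)
  case (1 x y)
  then show ?case
    by (auto simp: presented_group_carrier presented_group_mult)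
next
  case 2
  show ?case
    by (simp add: presented_group_carrier presented_group_one)
next
  case (3 x y z)
  then show ?case
    by (auto simp: presented_group_carrier presented_group_mult)
next
  case (4 x)
  then show ?case
    by (auto simp: presented_group_carrier presented_group_one presented_group_mult)
next
  case (5 x)
  then obtain u where u: "x = word_class E u"
    by (auto simp: presented_group_carrier)
  let ?y = "word_class E (rev (map (\<lambda>(g, b). (g, \<not> b)) u))"
  have "?y \<otimes>\<^bsub>presented_group E\<^esub> x = \<one>\<^bsub>presented_group E\<^esub>"
    unfolding u presented_group_mult presented_group_one word_class_eq_iff
    by (rule word_eq_left_inverse)
  moreover have "?y \<in> carrier (presented_group E)"
    by (simp add: presented_group_carrier)
  ultimately show ?case
    by (rule bexI)
qed

section \<open>Dihedral groups\<close>

datatype dihedral_gen = Rot | Refl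

text \<open>The relations are \<open>r\<^sup>n = 1\<close>, \<open>s\<^sup>2 = 1\<close> and \<open>s r s = r\<^sup>-\<^sup>1\<close>, with \<open>r = Rot\<close> and
  \<open>s = Refl\<close>.  The parameter \<open>n\<close> is half the group order.\<close>

definition dihedral_group :: "nat \<Rightarrow> dihedral_gen word set monoid" where
  "dihedral_group n = presented_group
    {(replicate n (Rot, True), []),
     ([(Refl, True), (Refl, True)], []),
     ([(Refl, True), (Rot, True), (Refl, True)], [(Rot, False)])}"

section \<open>Graphs and the second Zagreb index\<close>

text \<open>In a simple undirected graph an edge is the set of its two distinct endpoints.\<close>

record 'v sgraph =
  vertices :: "'v set"
  edges :: "'v set set"

definition vertex_degree :: "'v sgraph \<Rightarrow> 'v \<Rightarrow> nat" where
  "vertex_degree \<Gamma> v = card {e \<in> edges \<Gamma>. v \<in> e}"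

text \<open>For an edge \<open>e = {u, v}\<close> with \<open>u \<noteq> v\<close> the inner product is \<open>deg u * deg v\<close>; each
  undirected edge is counted once.\<close>

definition second_zagreb_index :: "'v sgraph \<Rightarrow> nat" where
  "second_zagreb_index \<Gamma> = (\<Sum>e\<in>edges \<Gamma>. \<Prod>v\<in>e. vertex_degree \<Gamma> v)"

definition proper_nontrivial_subgroups :: "('a, 'b) monoid_scheme \<Rightarrow> 'a set set" where
  "proper_nontrivial_subgroups G = {H. subgroup H G \<and> H \<noteq> carrier G \<and> H \<noteq> {\<one>\<^bsub>G\<^esub>}}"

definition intersection_graph :: "('a, 'b) monoid_scheme \<Rightarrow> 'a set sgraph" where
  "intersection_graph G =
    \<lparr>vertices = proper_nontrivial_subgroups G,
     edges = {{H, K} | H K. H \<in> proper_nontrivial_subgroups G \<and> K \<in> proper_nontrivial_subgroups G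
                \<and> H \<noteq> K \<and> H \<inter> K \<noteq> {\<one>\<^bsub>G\<^esub>}}\<rparr>"

end

theory Submission
  imports Defs
begin

text \<open>Comparing normal forms \<open>r\<^sup>i s\<^sup>b\<close> identifies the presented group with pairs
  \<open>(i, b)\<close>, \<open>i\<close> modulo \<open>n\<close>. For \<open>n = p\<^sup>2\<close> the proper non-trivial subgroups are
  \<open>\<langle>r\<rangle>\<close>, \<open>\<langle>r\<^sup>p\<rangle>\<close>, the \<open>p\<close> groups \<open>\<langle>r\<^sup>p, r\<^sup>i s\<rangle>\<close> and the
  \<open>p\<^sup>2\<close> groups \<open>\<langle>r\<^sup>k s\<rangle>\<close> of order 2. The first \<open>p + 2\<close> all contain \<open>r\<^sup>p\<close> and
  form a clique, while \<open>\<langle>r\<^sup>k s\<rangle>\<close> is a pendant vertex attached to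
  \<open>\<langle>r\<^sup>p, r\<^sup>i s\<rangle>\<close> with \<open>i = k mod p\<close>. So the degrees are \<open>p + 1\<close> (twice),
  \<open>2 p + 1\<close> (\<open>p\<close> times) and \<open>1\<close> (\<open>p\<^sup>2\<close> times), and twice the index is the sum over all
  vertices of the degree times the sum of the degrees of the neighbours.\<close>

section \<open>Normal forms in the dihedral group\<close>

text \<open>The coordinates \<open>e i b\<close> stand for \<open>r\<^sup>i s\<^sup>b\<close>.\<close>

locale dihedral_coords = group G for G (structure) +
  fixes n :: nat and e :: "int \<Rightarrow> bool \<Rightarrow> 'a"
  assumes n_pos: "n > 0"
    and carrier_eq: "carrier G = range (case_prod e)"
    and e_mult: "e i b \<otimes> e j c = e (if b then i - j else i + j) (b \<noteq> c)"
    and e_eq_iff: "e i b = e j c \<longleftrightarrow> b = c \<and> int n dvd i - j"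

definition dihedral_rels :: "nat \<Rightarrow> (dihedral_gen word \<times> dihedral_gen word) set" where
  "dihedral_rels n = {(replicate n (Rot, True), []),
     ([(Refl, True), (Refl, True)], []),
     ([(Refl, True), (Rot, True), (Refl, True)], [(Rot, False)])}"

lemma dihedral_group_eq: "dihedral_group n = presented_group (dihedral_rels n)"
  by (simp add: dihedral_group_def dihedral_rels_def)

text \<open>The exponents \<open>(i, b)\<close> of the normal form \<open>r\<^sup>i s\<^sup>b\<close> of a word, with \<open>i\<close> not yet reduced
  modulo \<open>n\<close>.\<close>

fun normal_exps :: "dihedral_gen word \<Rightarrow> int \<times> bool" where
  "normal_exps [] = (0, False)"
| "normal_exps ((Rot, t) # w) = (case normal_exps w of (i, b) \<Rightarrow> (if t then i + 1 else i - 1, b))"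
| "normal_exps ((Refl, t) # w) = (case normal_exps w of (i, b) \<Rightarrow> (- i, \<not> b))"

text \<open>Negative powers are spelled with formal inverses, so every integer exponent has its own
  word, independently of \<open>n\<close>.\<close>

definition rot_word :: "int \<Rightarrow> dihedral_gen word" where
  "rot_word i = (if i \<ge> 0 then replicate (nat i) (Rot, True) else replicate (nat (- i)) (Rot, False))"

definition normal_word :: "int \<Rightarrow> bool \<Rightarrow> dihedral_gen word" where
  "normal_word i b = rot_word i @ (if b then [(Refl, True)] else [])"

text \<open>This is multiplication in the infinite dihedral group: moving \<open>s\<close> past a
  power of \<open>r\<close> negates the exponent. Thus \<open>normal_exps\<close> is a homomorphism
  on words.\<close>

lemma normal_exps_append:
  "normal_exps (u @ v) = (case normal_exps u of (i, b) \<Rightarrow> case normal_exps v of (j, c) \<Rightarrow>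
     (if b then i - j else i + j, b \<noteq> c))"
  by (induction u rule: normal_exps.induct) (auto split: prod.splits)

lemma normal_exps_replicate_Rot:
  "normal_exps (replicate k (Rot, t)) = (if t then int k else - int k, False)"
  by (induction k) auto

lemma normal_exps_normal_word: "normal_exps (normal_word i b) = (i, b)"
  by (auto simp: normal_word_def rot_word_def normal_exps_append normal_exps_replicate_Rot)

text \<open>Modulo \<open>n\<close> the homomorphism \<open>normal_exps\<close> respects each
  defining relation, hence everything derived from them. This is the half that keeps the presented
  group from collapsing.\<close>

lemma word_eq_imp_normal_exps_cong:
  assumes "word_eq (dihedral_rels n) u v"
  shows "snd (normal_exps u) = snd (normal_exps v) \<and>
    int n dvd fst (normal_exps u) - fst (normal_exps v)"
  using assms
proof (induction rule: word_eq.induct)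
  case (word_sym u v)
  then show ?case by (simp add: dvd_diff_commute)
next
  case (word_trans u v w)
  then show ?case
    using dvd_add[of "int n" "fst (normal_exps u) - fst (normal_exps v)" "fst (normal_exps v) - fst (normal_exps w)"]
    by simp
next
  case (word_append u u' v v')
  obtain i b where u: "normal_exps u = (i, b)" by (cases "normal_exps u")
  obtain i' b' where u': "normal_exps u' = (i', b')" by (cases "normal_exps u'")
  obtain j c where v: "normal_exps v = (j, c)" by (cases "normal_exps v")
  obtain j' c' where v': "normal_exps v' = (j', c')" by (cases "normal_exps v'")
  have dvd: "int n dvd i - i'" "int n dvd j - j'" and bc: "b = b'" "c = c'"
    using word_append.IH by (simp_all add: u u' v v')
  have "int n dvd (i - j) - (i' - j')" "int n dvd (i + j) - (i' + j')"
    using dvd_diff[OF dvd] dvd_add[OF dvd] by (simp_all add: algebra_simps)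
  then show ?case
    by (simp add: u u' v v' bc normal_exps_append)
next
  case (word_cancel g t)
  then show ?case by (cases g) auto
next
  case (word_rel u v)
  then show ?case by (auto simp: dihedral_rels_def normal_exps_replicate_Rot)
qed simp

section \<open>Rewriting words to normal form\<close>

context
  fixes n :: nat
begin

abbreviation (input) weq (infix "\<approx>" 50) where "u \<approx> v \<equiv> word_eq (dihedral_rels n) u v"

lemmas [trans] = word_trans

lemma weq_Cons: "u \<approx> v \<Longrightarrow> x # u \<approx> x # v"
  using word_append[OF word_refl, of _ u v "[x]"] by simp

lemma weq_append_left: "u \<approx> v \<Longrightarrow> w @ u \<approx> w @ v"
  by (rule word_append[OF word_refl])

lemma weq_append_right: "u \<approx> v \<Longrightarrow> u @ w \<approx> v @ w"
  by (rule word_append[OF _ word_refl])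

lemma weq_cancel: "(g, t) # (g, \<not> t) # w \<approx> w"
  using weq_append_right[OF word_cancel[of _ g t], of w] by simp

text \<open>A letter of the same sign as the exponent, or any letter at exponent 0, lengthens the
  power; a letter of opposite sign cancels against its first letter.\<close>

lemma weq_Rot_rot_word: "(Rot, t) # rot_word i \<approx> rot_word (if t then i + 1 else i - 1)"
proof -
  consider (up) "t" "i \<ge> 0" | (up_neg) "t" "i < 0" | (down_pos) "\<not> t" "i > 0" | (down) "\<not> t" "i \<le> 0"
    by linarith
  then show ?thesis
  proof cases
    case up
    then have "nat (i + 1) = Suc (nat i)" by simp
    then show ?thesis using up by (simp add: rot_word_def word_refl)
  next
    case up_neg
    then have *: "nat (- i) = Suc (nat (- (i + 1)))" by simp
    have "rot_word i = (Rot, False) # rot_word (i + 1)"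
      using up_neg unfolding rot_word_def * by auto
    then show ?thesis using up_neg weq_cancel[of Rot True] by simp
  next
    case down_pos
    then have *: "nat i = Suc (nat (i - 1))" by simp
    have "rot_word i = (Rot, True) # rot_word (i - 1)"
      using down_pos unfolding rot_word_def * by auto
    then show ?thesis using down_pos weq_cancel[of Rot False] by simp
  next
    case down
    then have "nat (- (i - 1)) = Suc (nat (- i))" by simp
    then show ?thesis using down by (auto simp: rot_word_def word_refl)
  qed
qed

lemma weq_Refl_Refl: "(Refl, True) # (Refl, True) # w \<approx> w"
proof -
  have "[(Refl, True), (Refl, True)] \<approx> []"
    by (rule word_rel) (simp add: dihedral_rels_def)
  from weq_append_right[OF this, of w] show ?thesis by simp
qed

lemma weq_Refl_inv: "(Refl, False) # w \<approx> (Refl, True) # w"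
  \<comment> \<open>Insert \<open>s s\<close> after the inverse letter, then cancel that letter
    against the first \<open>s\<close>.\<close>
  by (rule word_trans[OF word_sym[OF weq_Cons[OF weq_Refl_Refl]]])
    (use weq_cancel[of Refl False] in simp)

lemma weq_Refl_Rot: "(Refl, True) # (Rot, t) # w \<approx> (Rot, \<not> t) # (Refl, True) # w"
proof -
  have rel: "(Refl, True) # (Rot, True) # (Refl, True) # w \<approx> (Rot, False) # w" for w
  proof -
    have "[(Refl, True), (Rot, True), (Refl, True)] \<approx> [(Rot, False)]"
      by (rule word_rel) (simp add: dihedral_rels_def)
    from weq_append_right[OF this, of w] show ?thesis by simp
  qed
  \<comment> \<open>Inserting \<open>s s\<close> after \<open>s r\<close> exposes the relator
    \<open>s r s\<close>.\<close>
  have down: "(Refl, True) # (Rot, True) # w \<approx> (Rot, False) # (Refl, True) # w" for w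
    using word_trans[OF word_sym[OF weq_Cons[OF weq_Cons[OF weq_Refl_Refl]]] rel] .
  \<comment> \<open>Put \<open>r\<close> and its inverse in front, apply \<open>down\<close>
    backwards, and cancel the pair of rotations that then meets before \<open>w\<close>.\<close>
  have up: "(Refl, True) # (Rot, False) # w \<approx> (Rot, True) # (Refl, True) # w"
  proof -
    have "(Refl, True) # (Rot, False) # w \<approx> (Rot, True) # (Rot, False) # (Refl, True) # (Rot, False) # w"
      using weq_cancel[of Rot True] by (simp add: word_sym)
    also have "\<dots> \<approx> (Rot, True) # (Refl, True) # (Rot, True) # (Rot, False) # w"
      by (rule weq_Cons[OF word_sym[OF down]])
    also have "\<dots> \<approx> (Rot, True) # (Refl, True) # w"
      using weq_cancel[of Rot True] by (intro weq_Cons) simp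
    finally show ?thesis .
  qed
  show ?thesis using up down by (cases t) auto
qed

lemma weq_Refl_replicate:
  "(Refl, True) # replicate k (Rot, t) @ w \<approx> replicate k (Rot, \<not> t) @ (Refl, True) # w"
proof (induction k)
  case (Suc k)
  show ?case
    using word_trans[OF weq_Refl_Rot weq_Cons[OF Suc]] by simp
qed (simp add: word_refl)

lemma weq_Refl_rot_word: "(Refl, True) # rot_word i @ w \<approx> rot_word (- i) @ (Refl, True) # w"
proof (cases "i = 0")
  case True
  then show ?thesis by (simp add: rot_word_def word_refl)
next
  case False
  then show ?thesis
    using weq_Refl_replicate[of "nat \<bar>i\<bar>" "i > 0" w] by (auto simp: rot_word_def)
qed

text \<open>Induction absorbs the letters one by one into the normal form of the remaining word: a
  rotation shifts the exponent, a reflection travels through the power and meets the final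
  \<open>s\<close>, if there is one.\<close>

lemma weq_normal_word: "normal_exps u = (i, b) \<Longrightarrow> u \<approx> normal_word i b"
proof (induction u arbitrary: i b rule: normal_exps.induct)
  case 1
  then show ?case by (simp add: normal_word_def rot_word_def word_refl)
next
  case (2 t w)
  obtain j c where w: "normal_exps w = (j, c)" by (cases "normal_exps w")
  have "(Rot, t) # w \<approx> (Rot, t) # normal_word j c"
    by (rule weq_Cons[OF "2.IH"[OF w]])
  also have "\<dots> \<approx> normal_word i b"
    using "2.prems" w weq_append_right[OF weq_Rot_rot_word[of t j]]
    by (auto simp: normal_word_def)
  finally show ?case .
next
  case (3 t w)
  obtain j c where w: "normal_exps w = (j, c)" by (cases "normal_exps w")
  have ib: "i = - j" "b = (\<not> c)" using "3.prems" w by auto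
  have "(Refl, t) # w \<approx> (Refl, True) # w"
    by (cases t) (simp_all add: word_refl weq_Refl_inv)
  also have "\<dots> \<approx> (Refl, True) # normal_word j c"
    by (rule weq_Cons[OF "3.IH"[OF w]])
  also have "\<dots> \<approx> rot_word (- j) @ (Refl, True) # (if c then [(Refl, True)] else [])"
    unfolding normal_word_def by (rule weq_Refl_rot_word)
  also have "\<dots> \<approx> normal_word i b"
    unfolding ib normal_word_def
    by (rule weq_append_left) (auto simp: weq_Refl_Refl word_refl)
  finally show ?case .
qed

text \<open>Both words reduce to the same normal word. Further identities between words become
  computations with exponents.\<close>

lemma weq_if_normal_exps_eq: "normal_exps u = normal_exps v \<Longrightarrow> u \<approx> v"
  by (metis weq_normal_word word_sym word_trans surj_pair)

lemma weq_replicate_mult: "replicate (n * k) (Rot, True) \<approx> []"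
proof (induction k)
  case (Suc k)
  have "replicate n (Rot, True) \<approx> []"
    by (rule word_rel) (simp add: dihedral_rels_def)
  then show ?case using word_append[OF _ Suc] by (simp add: replicate_add)
qed (simp add: word_refl)

lemma weq_normal_word_shift: "normal_word (i + int n * int k) b \<approx> normal_word i b"
proof -
  have "normal_word (i + int n * int k) b \<approx> replicate (n * k) (Rot, True) @ normal_word i b"
    by (rule weq_if_normal_exps_eq)
      (simp add: normal_exps_append normal_exps_normal_word normal_exps_replicate_Rot)
  also have "\<dots> \<approx> [] @ normal_word i b"
    by (rule weq_append_right[OF weq_replicate_mult])
  finally show ?thesis by simp
qed

lemma weq_normal_word_iff:
  "normal_word i b \<approx> normal_word j c \<longleftrightarrow> b = c \<and> int n dvd i - j"
proof
  assume "normal_word i b \<approx> normal_word j c"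
  then show "b = c \<and> int n dvd i - j"
    using word_eq_imp_normal_exps_cong by (fastforce simp: normal_exps_normal_word)
next
  assume *: "b = c \<and> int n dvd i - j"
  then obtain k where k: "i - j = int n * k" by auto
  \<comment> \<open>The shift is available for natural multiples of \<open>n\<close> only, so the
    sign of \<open>k\<close> decides which of the two exponents is shifted.\<close>
  show "normal_word i b \<approx> normal_word j c"
  proof (cases "k \<ge> 0")
    case True
    then have "i = j + int n * int (nat k)" using k by simp
    then show ?thesis using * True weq_normal_word_shift[of j "nat k" b] by simp
  next
    case False
    then have "j = i + int n * int (nat (- k))" using k by (simp add: algebra_simps)
    then show ?thesis
      using * False word_sym[OF weq_normal_word_shift[of i "nat (- k)" b]] by simp
  qed
qed

end

lemma dihedral_coords_dihedral_group:
  assumes "n > 0"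
  shows "dihedral_coords (dihedral_group n) n
    (\<lambda>i b. word_class (dihedral_rels n) (normal_word i b))"
  unfolding dihedral_group_eq
proof (intro dihedral_coords.intro dihedral_coords_axioms.intro group_presented_group assms)
  show "carrier (presented_group (dihedral_rels n)) =
    range (case_prod (\<lambda>i b. word_class (dihedral_rels n) (normal_word i b)))"
    unfolding presented_group_carrier
  proof (intro equalityI subsetI)
    fix x assume "x \<in> range (word_class (dihedral_rels n))"
    then obtain u where "x = word_class (dihedral_rels n) u" by auto
    moreover obtain i b where "normal_exps u = (i, b)" by (cases "normal_exps u")
    ultimately have "x = word_class (dihedral_rels n) (normal_word i b)"
      by (simp add: word_class_eq_iff weq_normal_word)
    then show "x \<in> range (case_prod (\<lambda>i b. word_class (dihedral_rels n) (normal_word i b)))"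
      by force
  qed auto
next
  fix i j :: int and b c :: bool
  show "word_class (dihedral_rels n) (normal_word i b) \<otimes>\<^bsub>presented_group (dihedral_rels n)\<^esub>
      word_class (dihedral_rels n) (normal_word j c) =
    word_class (dihedral_rels n) (normal_word (if b then i - j else i + j) (b \<noteq> c))"
    unfolding presented_group_mult word_class_eq_iff
    by (rule weq_if_normal_exps_eq) (simp add: normal_exps_append normal_exps_normal_word)
qed (simp add: word_class_eq_iff weq_normal_word_iff)

section \<open>Subgroups of the dihedral group\<close>

text \<open>The least positive element generates: the remainder of any element on division by it
  lies in \<open>A\<close> again and is smaller, hence zero.\<close>

lemma int_additive_subgroup_eq_multiples:
  fixes A :: "int set"
  assumes "m \<in> A" "m > 0" and diff: "\<And>x y. x \<in> A \<Longrightarrow> y \<in> A \<Longrightarrow> x - y \<in> A"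
  obtains d where "d > 0" "A = {x. d dvd x}"
proof -
  define k where "k = (LEAST k. k > 0 \<and> int k \<in> A)"
  have "nat m > 0 \<and> int (nat m) \<in> A" using assms by simp
  then have k: "k > 0" "int k \<in> A"
    unfolding k_def by (metis (mono_tags, lifting) LeastI)+
  have k_le: "k \<le> l" if "l > 0" "int l \<in> A" for l
    unfolding k_def using that by (intro Least_le) simp
  have zero: "0 \<in> A" using diff[OF k(2) k(2)] by simp
  have neg: "- x \<in> A" if "x \<in> A" for x using diff[OF zero that] by simp
  have add: "x + y \<in> A" if "x \<in> A" "y \<in> A" for x y using diff[OF that(1) neg[OF that(2)]] by simp
  have nmult: "int k * int q \<in> A" for q
    by (induction q) (auto simp: zero add k algebra_simps)
  have mult: "int k * q \<in> A" for q
  proof (cases "q \<ge> 0")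
    case True
    then show ?thesis using nmult[of "nat q"] by simp
  next
    case False
    then show ?thesis using neg[OF nmult[of "nat (- q)"]] by simp
  qed
  have "int k dvd x" if "x \<in> A" for x
  proof (rule ccontr)
    assume "\<not> int k dvd x"
    then have "x mod int k > 0"
      using k by (metis dvd_eq_mod_eq_0 of_nat_0_less_iff order_le_less pos_mod_sign)
    moreover have "x mod int k \<in> A"
      using diff[OF that mult[of "x div int k"]] by (simp add: minus_mult_div_eq_mod)
    ultimately have "k \<le> nat (x mod int k)"
      by (intro k_le) auto
    then show False using k pos_mod_bound[of "int k" x] by linarith
  qed
  then have "A = {x. int k dvd x}" using mult by (auto elim!: dvdE)
  then show ?thesis using k that[of "int k"] by simp
qed

context dihedral_coords
begin

lemma e_closed [simp]: "e i b \<in> carrier G"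
  by (auto simp: carrier_eq)

lemma carrier_cases: "x \<in> carrier G \<Longrightarrow> (\<And>i b. x = e i b \<Longrightarrow> P) \<Longrightarrow> P"
  by (auto simp: carrier_eq)

lemma one_eq: "\<one> = e 0 False"
  using e_mult[of 0 False 0 False] by (metis add_0 e_closed l_cancel_one)

lemma inv_e: "inv (e i b) = e (if b then i else - i) b"
  by (rule inv_equality) (auto simp: e_mult one_eq)

text \<open>For \<open>d\<close> dividing \<open>n\<close>, \<open>rotations d\<close> is \<open>\<langle>r\<^sup>d\<rangle>\<close> and \<open>dihedrals d j\<close> is
  \<open>\<langle>r\<^sup>d, r\<^sup>j s\<rangle>\<close>.\<close>

definition rotations :: "int \<Rightarrow> 'a set" where
  "rotations d = {e i False | i. d dvd i}"

definition dihedrals :: "int \<Rightarrow> int \<Rightarrow> 'a set" where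
  "dihedrals d j = rotations d \<union> {e i True | i. d dvd i - j}"

text \<open>An element has many coordinates \<open>e i b\<close>, with \<open>i\<close> varying by
  multiples of \<open>n\<close>. Since \<open>d\<close> divides \<open>n\<close>, the divisibility
  test gives the same answer for all of them.\<close>

lemma mem_rotations:
  assumes "d dvd int n"
  shows "e i b \<in> rotations d \<longleftrightarrow> \<not> b \<and> d dvd i"
proof -
  have "d dvd i" if "int n dvd i - j" "d dvd j" for j
    using dvd_add[OF dvd_trans[OF assms that(1)] that(2)] by simp
  moreover have "int n dvd i - i" by simp
  ultimately show ?thesis
    unfolding rotations_def e_eq_iff mem_Collect_eq by blast
qed

lemma mem_dihedrals:
  assumes "d dvd int n"
  shows "e i b \<in> dihedrals d j \<longleftrightarrow> (if b then d dvd i - j else d dvd i)"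
proof -
  have "d dvd i - j" if "int n dvd i - k" "d dvd k - j" for k
    using dvd_add[OF dvd_trans[OF assms that(1)] that(2)] by simp
  moreover have "int n dvd i - i" by simp
  ultimately have "e i b \<in> {e i True | i. d dvd i - j} \<longleftrightarrow> b \<and> d dvd i - j"
    unfolding e_eq_iff mem_Collect_eq by blast
  then show ?thesis
    unfolding dihedrals_def using mem_rotations[OF assms, of i b] by auto
qed

lemma subset_carrier_eqI:
  assumes "A \<subseteq> carrier G" "B \<subseteq> carrier G" "\<And>i b. e i b \<in> A \<longleftrightarrow> e i b \<in> B"
  shows "A = B"
  using assms carrier_cases by (metis subsetD subsetI subset_antisym)

lemma rotations_subset: "rotations d \<subseteq> carrier G"
  and dihedrals_subset: "dihedrals d j \<subseteq> carrier G"
  by (auto simp: rotations_def dihedrals_def)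

lemma subgroup_rotations:
  assumes "d dvd int n"
  shows "subgroup (rotations d) G"
proof (rule subgroupI[OF rotations_subset])
  show "rotations d \<noteq> {}" by (auto simp: rotations_def)
qed (auto simp: rotations_def inv_e e_mult)

lemma subgroup_dihedrals:
  assumes "d dvd int n"
  shows "subgroup (dihedrals d j) G"
proof (rule subgroupI[OF dihedrals_subset])
  show "dihedrals d j \<noteq> {}" by (auto simp: dihedrals_def rotations_def)
next
  fix x assume x: "x \<in> dihedrals d j"
  then show "inv x \<in> dihedrals d j"
    by (auto simp: dihedrals_def rotations_def inv_e)
next
  fix x y assume *: "x \<in> dihedrals d j" "y \<in> dihedrals d j"
  then obtain i b k c where xy: "x = e i b" "y = e k c"
    using dihedrals_subset carrier_cases by (metis subsetD)
  have "d dvd i - k - j" if "d dvd i - j" "d dvd k"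
    using dvd_diff[OF that] by (simp add: algebra_simps)
  moreover have "d dvd i - k" if "d dvd i - j" "d dvd k - j"
    using dvd_diff[OF that] by simp
  moreover have "d dvd i + k - j" if "d dvd i" "d dvd k - j"
    using dvd_add[OF that] by (simp add: algebra_simps)
  ultimately show "x \<otimes> y \<in> dihedrals d j"
    using * unfolding xy e_mult mem_dihedrals[OF assms] by (auto split: if_splits)
qed

text \<open>The exponents of the rotations in \<open>H\<close> form a subgroup of the integers
  containing \<open>n\<close>, so they are the multiples of some divisor \<open>d\<close> of
  \<open>n\<close>. If \<open>H\<close> contains a reflection \<open>r^j s\<close>, its reflections
  are the products of its rotations with that one.\<close>

lemma subgroup_cases:
  assumes "subgroup H G"
  obtains d where "d > 0" "d dvd int n" "H = rotations d"
  | d j where "d > 0" "d dvd int n" "H = dihedrals d j"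
proof -
  interpret H: subgroup H G by fact
  define A where "A = {i. e i False \<in> H}"
  have "e (int n) False = \<one>" by (simp add: one_eq e_eq_iff)
  then have nA: "int n \<in> A" by (simp add: A_def)
  have diff: "x - y \<in> A" if "x \<in> A" "y \<in> A" for x y
  proof -
    have "e x False \<otimes> inv (e y False) \<in> H"
      using that by (simp add: A_def)
    then show ?thesis by (simp add: A_def inv_e e_mult)
  qed
  obtain d where d: "d > 0" "A = {x. d dvd x}"
    using int_additive_subgroup_eq_multiples[of "int n" A] nA n_pos diff by auto
  have dn: "d dvd int n" using nA d by simp
  have F: "e i False \<in> H \<longleftrightarrow> d dvd i" for i using d by (auto simp: A_def)
  show ?thesis
  proof (cases "\<exists>j. e j True \<in> H")
    case False
    have "H = rotations d"
    proof (rule subset_carrier_eqI[OF H.subset rotations_subset])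
      show "e i b \<in> H \<longleftrightarrow> e i b \<in> rotations d" for i b
        using False F by (cases b) (auto simp: mem_rotations[OF dn])
    qed
    then show ?thesis using that(1) d dn by blast
  next
    case True
    then obtain j where j: "e j True \<in> H" by auto
    have "e i True \<in> H \<longleftrightarrow> d dvd i - j" for i
    proof
      assume "e i True \<in> H"
      \<comment> \<open>The product of two reflections is the rotation by the difference of their
        exponents.\<close>
      then have "e i True \<otimes> e j True \<in> H" using j by simp
      then show "d dvd i - j" by (simp add: e_mult F)
    next
      assume "d dvd i - j"
      then have "e (i - j) False \<otimes> e j True \<in> H" using j F by blast
      then show "e i True \<in> H" by (simp add: e_mult)
    qed
    then have "H = dihedrals d j"
      by (intro subset_carrier_eqI[OF H.subset dihedrals_subset])
        (auto simp: mem_dihedrals[OF dn] F)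
    then show ?thesis using that(2) d dn by blast
  qed
qed

section \<open>Equality of subgroups and the extreme parameters\<close>

lemma dihedrals_cong:
  assumes "d dvd j - k"
  shows "dihedrals d j = dihedrals d k"
proof -
  have "d dvd i - j \<longleftrightarrow> d dvd i - k" for i
    using dvd_add_left_iff[OF assms, of "i - j"] by simp
  then show ?thesis by (simp add: dihedrals_def)
qed

lemma dihedrals_mod: "dihedrals d (j mod d) = dihedrals d j"
  by (rule dihedrals_cong) (metis dvd_minus_mod dvd_diff_commute)

lemma rotations_inject:
  assumes "d dvd int n" "d' dvd int n" "d > 0" "d' > 0"
  shows "rotations d = rotations d' \<longleftrightarrow> d = d'"
  using mem_rotations assms by (metis dvd_refl zdvd_antisym_nonneg less_imp_le)

lemma rotations_neq_dihedrals:
  assumes "d dvd int n" "d' dvd int n"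
  shows "rotations d \<noteq> dihedrals d' j"
  using mem_rotations[OF assms(1), of j True] mem_dihedrals[OF assms(2), of j True j] by auto

lemma dihedrals_eq_iff:
  assumes "d dvd int n" "d' dvd int n" "d > 0" "d' > 0"
  shows "dihedrals d j = dihedrals d' k \<longleftrightarrow> d = d' \<and> d dvd j - k"
proof
  assume eq: "dihedrals d j = dihedrals d' k"
  then have "d dvd i \<longleftrightarrow> d' dvd i" for i
    using mem_dihedrals[OF assms(1), of i False j] mem_dihedrals[OF assms(2), of i False k] by simp
  then have "d = d'" using assms by (metis dvd_refl zdvd_antisym_nonneg less_imp_le)
  moreover have "d' dvd j - k"
    using eq mem_dihedrals[OF assms(1), of j True j] mem_dihedrals[OF assms(2), of j True k] by simp
  ultimately show "d = d' \<and> d dvd j - k" by simp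
qed (use dihedrals_cong in blast)

lemma rotations_n: "rotations (int n) = {\<one>}"
  by (rule subset_carrier_eqI) (auto simp: rotations_subset mem_rotations one_eq e_eq_iff)

lemma dihedrals_n: "dihedrals (int n) j = {\<one>, e j True}"
  by (rule subset_carrier_eqI) (auto simp: dihedrals_subset mem_dihedrals one_eq e_eq_iff)

lemma dihedrals_1: "dihedrals 1 j = carrier G"
  by (rule subset_carrier_eqI) (auto simp: dihedrals_subset mem_dihedrals)

end

section \<open>Zagreb indices\<close>

text \<open>Intended for irreflexive symmetric \<open>adj\<close>; then every edge has two distinct
  endpoints, adjacent in both orders.\<close>

definition simple_sgraph :: "'v set \<Rightarrow> ('v \<Rightarrow> 'v \<Rightarrow> bool) \<Rightarrow> 'v sgraph" where
  "simple_sgraph V adj = \<lparr>vertices = V, edges = {{u, v} | u v. u \<in> V \<and> v \<in> V \<and> adj u v}\<rparr>"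

lemma vertex_degree_simple_sgraph:
  assumes "u \<in> V" "irreflp adj" "symp adj"
  shows "vertex_degree (simple_sgraph V adj) u = card {v \<in> V. adj u v}"
proof -
  have "bij_betw (\<lambda>v. {u, v}) {v \<in> V. adj u v} {e \<in> edges (simple_sgraph V adj). u \<in> e}"
    using assms unfolding bij_betw_def inj_on_def simple_sgraph_def
    by (auto simp: doubleton_eq_iff dest: sympD)
  then show ?thesis
    unfolding vertex_degree_def by (simp add: bij_betw_same_card)
qed

text \<open>Double counting over ordered adjacent pairs: each edge arises from exactly two of them,
  with the same product of degrees.\<close>

lemma second_zagreb_index_simple_sgraph:
  assumes "finite V" "irreflp adj" "symp adj"
  defines "deg \<equiv> \<lambda>u. card {v \<in> V. adj u v}"
  shows "2 * second_zagreb_index (simple_sgraph V adj) =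
    (\<Sum>u\<in>V. deg u * (\<Sum>v | v \<in> V \<and> adj u v. deg v))"
proof -
  let ?darts = "SIGMA u:V. {v \<in> V. adj u v}"
  let ?E = "edges (simple_sgraph V adj)"
  have fin: "finite ?darts" using assms by auto
  have E: "?E = (\<lambda>(u, v). {u, v}) ` ?darts"
    by (auto simp: simple_sgraph_def)
  have fibre: "(\<Sum>d | d \<in> ?darts \<and> (case d of (u, v) \<Rightarrow> {u, v}) = e. deg (fst d) * deg (snd d)) =
      2 * (\<Prod>v\<in>e. vertex_degree (simple_sgraph V adj) v)" if "e \<in> ?E" for e
  proof -
    obtain u v where uv: "e = {u, v}" "u \<in> V" "v \<in> V" "adj u v"
      using \<open>e \<in> ?E\<close> by (auto simp: simple_sgraph_def)
    have "u \<noteq> v" using uv assms by (auto dest: irreflpD)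
    have "{d. d \<in> ?darts \<and> (case d of (u, v) \<Rightarrow> {u, v}) = e} = {(u, v), (v, u)}"
      using uv assms by (auto simp: doubleton_eq_iff dest: sympD)
    then show ?thesis
      using \<open>u \<noteq> v\<close> uv vertex_degree_simple_sgraph[OF _ assms(2,3)]
      by (simp add: deg_def)
  qed
  have "(\<Sum>u\<in>V. deg u * (\<Sum>v | v \<in> V \<and> adj u v. deg v)) = (\<Sum>d\<in>?darts. deg (fst d) * deg (snd d))"
    using assms by (simp add: sum_distrib_left sum.Sigma case_prod_beta)
  also have "\<dots> = (\<Sum>e\<in>?E. \<Sum>d | d \<in> ?darts \<and> (case d of (u, v) \<Rightarrow> {u, v}) = e. deg (fst d) * deg (snd d))"
    unfolding E by (rule sum.image_gen[OF fin])
  also have "\<dots> = (\<Sum>e\<in>?E. 2 * (\<Prod>v\<in>e. vertex_degree (simple_sgraph V adj) v))"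
    by (intro sum.cong fibre refl)
  finally show ?thesis
    by (simp add: second_zagreb_index_def sum_distrib_left)
qed

lemma intersection_graph_eq:
  "intersection_graph G =
     simple_sgraph (proper_nontrivial_subgroups G) (\<lambda>H K. H \<noteq> K \<and> H \<inter> K \<noteq> {\<one>\<^bsub>G\<^esub>})"
  unfolding intersection_graph_def simple_sgraph_def by simp

section \<open>The intersection graph for \<open>n = p\<^sup>2\<close>\<close>

locale dihedral_coords_prime_square = dihedral_coords +
  fixes p :: nat
  assumes prime_p: "prime p" and n_eq: "n = p ^ 2"
begin

lemma p_gt_1: "p > 1"
  using prime_p by (rule prime_gt_1_nat)

lemma dvd_n [simp]: "p dvd n" "int p dvd int n"
  by (simp_all add: n_eq)

lemma p_less_n: "p < n"
  using p_gt_1 by (simp add: n_eq power2_eq_square)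

lemma divisor_cases:
  assumes "d > 0" "d dvd int n"
  obtains "d = 1" | "d = int p" | "d = int n"
proof -
  have "nat d dvd p ^ 2"
    using assms by (simp add: n_eq nat_dvd_iff)
  then obtain k where "k \<le> 2" "nat d = p ^ k"
    using prime_p by (auto simp: divides_primepow_nat)
  then have "nat d = 1 \<or> nat d = p \<or> nat d = n"
    by (auto simp: n_eq le_Suc_eq numeral_2_eq_2)
  then show thesis
    using that assms by linarith
qed

text \<open>Indices below \<open>p\<close> suffice, because \<open>dihedrals d j\<close> depends
  only on \<open>j\<close> modulo \<open>d\<close>; likewise indices below \<open>n\<close> for
  \<open>leaves\<close>.\<close>

definition core :: "'a set set" where
  "core = insert (rotations 1) (insert (rotations (int p)) (dihedrals (int p) ` int ` {..<p}))"

definition leaves :: "'a set set" where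
  "leaves = dihedrals (int n) ` int ` {..<n}"

definition meets :: "'a set \<Rightarrow> 'a set \<Rightarrow> bool" where
  "meets H K \<longleftrightarrow> H \<noteq> K \<and> H \<inter> K \<noteq> {\<one>}"

lemma dihedrals_in_image:
  assumes "m > 0"
  shows "dihedrals (int m) j \<in> dihedrals (int m) ` int ` {..<m}"
proof -
  have "j mod int m = int (nat (j mod int m))" "nat (j mod int m) < m"
    using assms by (auto simp: nat_less_iff)
  then show ?thesis
    using dihedrals_mod[of "int m" j] by (metis imageI lessThan_iff)
qed

text \<open>The divisor \<open>d\<close> is 1, \<open>p\<close> or \<open>n\<close>. Among the
  resulting subgroups only \<open>rotations n\<close> is trivial and only
  \<open>dihedrals 1 j\<close> is the whole group.\<close>

lemma proper_nontrivial_subgroups_eq: "proper_nontrivial_subgroups G = core \<union> leaves"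
proof (intro equalityI subsetI)
  fix H assume "H \<in> proper_nontrivial_subgroups G"
  then have H: "subgroup H G" "H \<noteq> carrier G" "H \<noteq> {\<one>}"
    by (auto simp: proper_nontrivial_subgroups_def)
  from H(1) show "H \<in> core \<union> leaves"
  proof (cases rule: subgroup_cases)
    case (1 d)
    from 1(1,2) have "d = 1 \<or> d = int p \<or> d = int n" by (rule divisor_cases) simp_all
    then have "d = 1 \<or> d = int p" using H(3) 1(3) rotations_n by blast
    then show ?thesis using 1(3) by (auto simp: core_def)
  next
    case (2 d j)
    from 2(1,2) have "d = 1 \<or> d = int p \<or> d = int n" by (rule divisor_cases) simp_all
    then have "d = int p \<or> d = int n" using H(2) 2(3) dihedrals_1 by blast
    then show ?thesis
      using 2(3) dihedrals_in_image[of p j] dihedrals_in_image[of n j] n_pos p_gt_1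
      unfolding core_def leaves_def by auto
  qed
next
  fix H assume "H \<in> core \<union> leaves"
  then obtain d j where d: "d > 0" "d dvd int n"
    and H: "H = rotations d \<and> d \<noteq> int n \<or> H = dihedrals d j \<and> d \<noteq> 1"
  proof -
    consider "H = rotations 1" | "H = rotations (int p)" | j where "H = dihedrals (int p) j"
      | j where "H = dihedrals (int n) j"
      using \<open>H \<in> core \<union> leaves\<close> unfolding core_def leaves_def by blast
    then show thesis
      by cases (use that[of 1] that[of "int p"] that[of "int n"] p_gt_1 p_less_n dvd_n in auto)
  qed
  from H show "H \<in> proper_nontrivial_subgroups G"
  proof
    assume H: "H = rotations d \<and> d \<noteq> int n"
    \<comment> \<open>With the whole group read as \<open>dihedrals 1 0\<close> and the trivial one
      as \<open>rotations n\<close>, both claims compare parameters of known families.\<close>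
    then have "H \<noteq> carrier G" "H \<noteq> {\<one>}"
      using d n_pos rotations_neq_dihedrals[of d 1 0] rotations_inject[of d "int n"]
      by (auto simp: dihedrals_1 rotations_n)
    then show ?thesis
      using H d subgroup_rotations by (auto simp: proper_nontrivial_subgroups_def)
  next
    assume H: "H = dihedrals d j \<and> d \<noteq> 1"
    then have "H \<noteq> carrier G" "H \<noteq> {\<one>}"
      using d n_pos rotations_neq_dihedrals[of "int n" d j] dihedrals_eq_iff[of d 1 j 0]
      by (auto simp: dihedrals_1 rotations_n)
    then show ?thesis
      using H d subgroup_dihedrals by (auto simp: proper_nontrivial_subgroups_def)
  qed
qed

lemma intersection_graph_eq_core_leaves:
  "intersection_graph G = simple_sgraph (core \<union> leaves) meets"
  unfolding intersection_graph_eq proper_nontrivial_subgroups_eq meets_def ..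

lemma irreflp_meets: "irreflp meets" and symp_meets: "symp meets"
  by (auto simp: meets_def irreflp_def symp_def)

lemma inj_dihedrals:
  assumes "m > 0" "int m dvd int n"
  shows "inj_on (\<lambda>k. dihedrals (int m) (int k)) {..<m}"
proof (rule inj_onI)
  fix k l assume "k \<in> {..<m}" "l \<in> {..<m}" "dihedrals (int m) (int k) = dihedrals (int m) (int l)"
  then have "int m dvd int k - int l" "k < m" "l < m"
    using assms by (simp_all add: dihedrals_eq_iff del: of_nat_dvd_iff)
  then have "int k mod int m = int l mod int m" "k < m" "l < m"
    by (simp_all only: mod_eq_dvd_iff)
  then show "k = l" by simp
qed

text \<open>Every member of the core contains \<open>r\<^sup>p\<close>.\<close>

lemma core_meets_core:
  assumes "H \<in> core" "K \<in> core"
  shows "meets H K \<longleftrightarrow> H \<noteq> K"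
proof -
  have "e (int p) False \<in> H" "e (int p) False \<in> K"
    using assms by (auto simp: core_def mem_rotations mem_dihedrals)
  moreover have "e (int p) False \<noteq> \<one>"
    using p_less_n p_gt_1 by (auto simp: one_eq e_eq_iff dest: zdvd_imp_le)
  ultimately show ?thesis by (auto simp: meets_def)
qed

text \<open>Needed because an empty intersection would also differ from the trivial subgroup and so
  count as adjacency.\<close>

lemma one_mem: "H \<in> core \<union> leaves \<Longrightarrow> \<one> \<in> H"
  using proper_nontrivial_subgroups_eq subgroup.one_closed
  unfolding proper_nontrivial_subgroups_def by fastforce

text \<open>A leaf is the identity together with the single reflection \<open>r^k s\<close>, so only
  that reflection can be a non-trivial common element.\<close>

lemma meets_leaf:
  assumes "H \<in> core \<union> leaves"
  shows "meets H (dihedrals (int n) k) \<longleftrightarrow> H \<noteq> dihedrals (int n) k \<and> e k True \<in> H"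
  using one_mem[OF assms] e_eq_iff[of k True 0 False]
  by (auto simp: meets_def dihedrals_n one_eq)

lemma leaf_meets_leaf:
  assumes "H \<in> leaves" "K \<in> leaves"
  shows "\<not> meets H K"
proof -
  obtain j k where H: "H = dihedrals (int n) j" and K: "K = dihedrals (int n) k"
    using assms by (auto simp: leaves_def)
  have "meets H K \<longleftrightarrow> H \<noteq> K \<and> e k True \<in> H"
    unfolding K using assms(1) by (intro meets_leaf) simp
  moreover have "K = H" if "e k True \<in> H"
    using that unfolding H K by (intro dihedrals_cong) (simp add: mem_dihedrals)
  ultimately show ?thesis by blast
qed

lemma rotations_meets_leaf:
  assumes "rotations d \<in> core" "d dvd int n" "K \<in> leaves"
  shows "\<not> meets (rotations d) K"
  using assms by (auto simp: leaves_def meets_leaf mem_rotations)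

text \<open>The reflection \<open>r^k s\<close> lies in the subgroup with index \<open>i\<close> iff
  \<open>p\<close> divides \<open>k - i\<close>, which for \<open>i < p\<close> pins
  \<open>i\<close> down as a remainder.\<close>

lemma dihedrals_meets_leaf:
  assumes "i < p"
  shows "meets (dihedrals (int p) (int i)) (dihedrals (int n) (int k)) \<longleftrightarrow> k mod p = i"
proof -
  have "dihedrals (int p) (int i) \<in> core" using assms by (auto simp: core_def)
  then have "meets (dihedrals (int p) (int i)) (dihedrals (int n) (int k)) \<longleftrightarrow> int p dvd int k - int i"
    using p_less_n p_gt_1 n_pos by (simp add: meets_leaf mem_dihedrals dihedrals_eq_iff)
  also have "\<dots> \<longleftrightarrow> k mod p = i"
    using assms by (metis mod_eq_dvd_iff mod_less of_nat_eq_iff zmod_int)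
  finally show ?thesis .
qed

section \<open>Sums over core and leaves\<close>

lemma finite_core: "finite core" and finite_leaves: "finite leaves"
  by (auto simp: core_def leaves_def)

lemma core_distinct:
  "rotations 1 \<noteq> rotations (int p)"
  "rotations 1 \<notin> dihedrals (int p) ` int ` {..<p}"
  "rotations (int p) \<notin> dihedrals (int p) ` int ` {..<p}"
  using p_gt_1 by (auto simp: rotations_inject rotations_neq_dihedrals)

lemma core_disjoint_leaves: "core \<inter> leaves = {}"
  using p_gt_1 p_less_n by (auto simp: core_def leaves_def rotations_neq_dihedrals dihedrals_eq_iff)

lemma sum_dihedrals:
  assumes "m > 0" "int m dvd int n"
  shows "sum f (dihedrals (int m) ` int ` {..<m}) = (\<Sum>k<m. f (dihedrals (int m) (int k)))"
  unfolding image_image by (rule sum.reindex_cong[OF inj_dihedrals[OF assms]]) auto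

lemma sum_core:
  "sum f core = f (rotations 1) + f (rotations (int p)) + (\<Sum>i<p. f (dihedrals (int p) (int i)))"
  for f :: "'a set \<Rightarrow> nat"
  unfolding core_def using core_distinct p_gt_1 by (simp add: sum_dihedrals)

lemma sum_leaves:
  "sum f leaves = (\<Sum>k<n. f (dihedrals (int n) (int k)))"
  unfolding leaves_def using n_pos by (simp add: sum_dihedrals)

lemma card_core: "card core = p + 2"
  using sum_core[of "\<lambda>_. 1"] by simp

section \<open>Neighbourhoods of the vertices\<close>

definition nbrs :: "'a set \<Rightarrow> 'a set set" where
  "nbrs H = {K \<in> core \<union> leaves. meets H K}"

text \<open>Rotation subgroups contain no reflection, so they meet no leaf and see just the rest of
  the clique.\<close>

lemma nbrs_rotations:
  assumes "d = 1 \<or> d = int p"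
  shows "nbrs (rotations d) = core - {rotations d}"
proof -
  have "rotations d \<in> core" "d dvd int n" using assms by (auto simp: core_def)
  then show ?thesis
    unfolding nbrs_def using core_meets_core rotations_meets_leaf by blast
qed

lemma nbrs_dihedrals:
  assumes "i < p"
  shows "nbrs (dihedrals (int p) (int i)) =
    (core - {dihedrals (int p) (int i)}) \<union>
    (\<lambda>k. dihedrals (int n) (int k)) ` {k. k < n \<and> k mod p = i}"
proof -
  have "dihedrals (int p) (int i) \<in> core" using assms by (auto simp: core_def)
  then have "K \<in> core \<Longrightarrow> meets (dihedrals (int p) (int i)) K \<longleftrightarrow> K \<noteq> dihedrals (int p) (int i)" for K
    using core_meets_core by blast
  moreover have "{K \<in> leaves. meets (dihedrals (int p) (int i)) K} =
      (\<lambda>k. dihedrals (int n) (int k)) ` {k. k < n \<and> k mod p = i}"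
    using dihedrals_meets_leaf[OF assms] by (auto simp: leaves_def)
  ultimately show ?thesis unfolding nbrs_def by blast
qed

lemma nbrs_leaf:
  assumes "k < n"
  shows "nbrs (dihedrals (int n) (int k)) = {dihedrals (int p) (int (k mod p))}"
proof -
  let ?L = "dihedrals (int n) (int k)" and ?D = "dihedrals (int p) (int (k mod p))"
  have leaf: "?L \<in> leaves" using assms by (auto simp: leaves_def)
  have mod_less: "k mod p < p" using p_gt_1 by simp
  then have D: "?D \<in> core" by (auto simp: core_def)
  have not_rot: "\<not> meets (rotations d) ?L" if "d = 1 \<or> d = int p" for d
    using that by (intro rotations_meets_leaf[OF _ _ leaf]) (auto simp: core_def)
  have "meets H ?L \<longleftrightarrow> H = ?D" if "H \<in> core" for H
  proof -
    consider (rot) d where "d = 1 \<or> d = int p" "H = rotations d"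
      | (dih) i where "i < p" "H = dihedrals (int p) (int i)"
      using \<open>H \<in> core\<close> unfolding core_def by blast
    then show ?thesis
    proof cases
      case rot
      \<comment> \<open>A rotation subgroup misses the leaf while \<open>?D\<close> meets it, so the
        two differ and both sides are false.\<close>
      then show ?thesis
        using not_rot[of d] dihedrals_meets_leaf[OF mod_less, of k] by auto
    next
      case (dih i)
      have "H = ?D \<longleftrightarrow> i = k mod p"
        unfolding dih(2) using inj_on_eq_iff[OF inj_dihedrals[of p], of i "k mod p"] dih(1) mod_less
        by simp
      moreover have "meets H ?L \<longleftrightarrow> k mod p = i"
        unfolding dih(2) by (rule dihedrals_meets_leaf[OF dih(1)])
      ultimately show ?thesis by auto
    qed
  qed
  moreover have "meets ?L K \<longleftrightarrow> meets K ?L" for K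
    using symp_meets by (blast dest: sympD)
  ultimately have "K \<in> core \<Longrightarrow> meets ?L K \<longleftrightarrow> K = ?D" for K
    by blast
  then have "K \<in> nbrs ?L \<longleftrightarrow> K = ?D" for K
    unfolding nbrs_def using leaf_meets_leaf[OF leaf, of K] D by blast
  then show ?thesis by auto
qed

section \<open>Degrees\<close>

lemma card_residue_class:
  assumes "i < p"
  shows "card {k. k < n \<and> k mod p = i} = p"
proof -
  \<comment> \<open>Division with remainder; the quotient ranges over exactly the numbers below
    \<open>p\<close> because \<open>n\<close> is the square of \<open>p\<close>.\<close>
  have "bij_betw (\<lambda>q. p * q + i) {..<p} {k. k < n \<and> k mod p = i}"
  proof (rule bij_betw_byWitness[where f' = "\<lambda>k. k div p"])
    have "p * q + i < n" if "q < p" for q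
    proof -
      have "p * q + i < p * (q + 1)" using assms by simp
      also have "\<dots> \<le> p * p" using that by (intro mult_le_mono2) simp
      finally show ?thesis by (simp add: n_eq power2_eq_square)
    qed
    then show "(\<lambda>q. p * q + i) ` {..<p} \<subseteq> {k. k < n \<and> k mod p = i}"
      using assms by auto
    show "(\<lambda>k. k div p) ` {k. k < n \<and> k mod p = i} \<subseteq> {..<p}"
      using p_gt_1 by (auto simp: n_eq power2_eq_square less_mult_imp_div_less)
  qed (use assms in auto)
  then show ?thesis
    using bij_betw_same_card by fastforce
qed

lemma inj_leaf: "inj_on (\<lambda>k. dihedrals (int n) (int k)) {k. k < n \<and> k mod p = i}"
  by (rule inj_on_subset[OF inj_dihedrals[OF n_pos]]) auto

lemma leaves_part_disjoint:
  "core \<inter> (\<lambda>k. dihedrals (int n) (int k)) ` {k. k < n \<and> k mod p = i} = {}"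
  using core_disjoint_leaves by (auto simp: leaves_def)

lemma card_nbrs_rotations: "d = 1 \<or> d = int p \<Longrightarrow> card (nbrs (rotations d)) = p + 1"
  using card_core by (subst nbrs_rotations) (auto simp: core_def intro: card_Diff_singleton[THEN trans])

text \<open>There are \<open>p + 1\<close> neighbours in the clique and \<open>p\<close> leaves, one
  for each \<open>k < n\<close> in the residue class of \<open>i\<close>.\<close>

lemma card_nbrs_dihedrals:
  assumes "i < p"
  shows "card (nbrs (dihedrals (int p) (int i))) = 2 * p + 1"
proof -
  have "dihedrals (int p) (int i) \<in> core" using assms by (auto simp: core_def)
  then show ?thesis
    unfolding nbrs_dihedrals[OF assms] using leaves_part_disjoint[of i]
    by (subst card_Un_disjoint)
      (auto simp: finite_core card_core card_image[OF inj_leaf] card_residue_class[OF assms])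
qed

lemma card_nbrs_leaf: "k < n \<Longrightarrow> card (nbrs (dihedrals (int n) (int k))) = 1"
  by (simp add: nbrs_leaf)

section \<open>Sums of neighbour degrees and the index\<close>

lemma sum_core_degrees: "(\<Sum>H\<in>core. card (nbrs H)) = 2 * (p + 1) + p * (2 * p + 1)"
  by (simp add: sum_core card_nbrs_rotations card_nbrs_dihedrals)

lemma sum_nbrs_rotations:
  assumes "d = 1 \<or> d = int p"
  shows "(\<Sum>K\<in>nbrs (rotations d). card (nbrs K)) = (p + 1) + p * (2 * p + 1)"
proof -
  have "rotations d \<in> core" using assms by (auto simp: core_def)
  from sum.remove[OF finite_core this, of "\<lambda>H. card (nbrs H)"] show ?thesis
    unfolding nbrs_rotations[OF assms, symmetric]
    using assms by (simp add: sum_core_degrees card_nbrs_rotations)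
qed

lemma sum_nbrs_dihedrals:
  assumes "i < p"
  shows "(\<Sum>K\<in>nbrs (dihedrals (int p) (int i)). card (nbrs K)) =
    2 * (p + 1) + (p - 1) * (2 * p + 1) + p"
proof -
  let ?D = "dihedrals (int p) (int i)"
  let ?L = "(\<lambda>k. dihedrals (int n) (int k)) ` {k. k < n \<and> k mod p = i}"
  have "?D \<in> core" using assms by (auto simp: core_def)
  from sum.remove[OF finite_core this, of "\<lambda>H. card (nbrs H)"]
  have "2 * (p + 1) + p * (2 * p + 1) = 2 * p + 1 + (\<Sum>K\<in>core - {?D}. card (nbrs K))"
    by (simp only: sum_core_degrees card_nbrs_dihedrals[OF assms])
  \<comment> \<open>One of the \<open>p\<close> equal summands is split off so that the vertex's own
    degree cancels without subtracting naturals.\<close>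
  moreover have "p * (2 * p + 1) = (p - 1) * (2 * p + 1) + (2 * p + 1)"
    using p_gt_1 by (simp add: mult_eq_if)
  ultimately have "(\<Sum>K\<in>core - {?D}. card (nbrs K)) = 2 * (p + 1) + (p - 1) * (2 * p + 1)"
    by linarith
  moreover have "(\<Sum>K\<in>?L. card (nbrs K)) = p"
    by (subst sum.reindex[OF inj_leaf])
      (simp add: card_nbrs_leaf card_residue_class[OF assms])
  moreover have "(core - {?D}) \<inter> ?L = {}" using leaves_part_disjoint by blast
  ultimately show ?thesis
    unfolding nbrs_dihedrals[OF assms] by (subst sum.union_disjoint) (auto simp: finite_core)
qed

lemma sum_nbrs_leaf:
  "k < n \<Longrightarrow> (\<Sum>K\<in>nbrs (dihedrals (int n) (int k)). card (nbrs K)) = 2 * p + 1"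
  using p_gt_1 by (simp only: nbrs_leaf) (simp add: card_nbrs_dihedrals)

text \<open>The three summands come from the two rotation subgroups, the \<open>p\<close> dihedral
  core vertices and the \<open>n\<close> leaves, each vertex giving its degree times its sum of
  neighbour degrees.\<close>

lemma twice_second_zagreb_index:
  "2 * second_zagreb_index (intersection_graph G) =
    2 * ((p + 1) * ((p + 1) + p * (2 * p + 1))) +
    p * ((2 * p + 1) * (2 * (p + 1) + (p - 1) * (2 * p + 1) + p)) +
    n * (2 * p + 1)"
proof -
  let ?f = "\<lambda>H. card (nbrs H) * (\<Sum>K\<in>nbrs H. card (nbrs K))"
  have "2 * second_zagreb_index (intersection_graph G) = sum ?f (core \<union> leaves)"
    unfolding intersection_graph_eq_core_leaves nbrs_def
    by (rule second_zagreb_index_simple_sgraph)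
      (simp_all add: finite_core finite_leaves irreflp_meets symp_meets)
  also have "\<dots> = sum ?f core + sum ?f leaves"
    by (rule sum.union_disjoint[OF finite_core finite_leaves core_disjoint_leaves])
  also have "\<dots> = 2 * ((p + 1) * ((p + 1) + p * (2 * p + 1))) +
      p * ((2 * p + 1) * (2 * (p + 1) + (p - 1) * (2 * p + 1) + p)) + n * (2 * p + 1)"
  proof -
    have "(\<Sum>i<p. ?f (dihedrals (int p) (int i))) =
        (\<Sum>i<p. (2 * p + 1) * (2 * (p + 1) + (p - 1) * (2 * p + 1) + p))"
      by (intro sum.cong refl) (simp only: card_nbrs_dihedrals sum_nbrs_dihedrals lessThan_iff)
    moreover have "(\<Sum>k<n. ?f (dihedrals (int n) (int k))) = (\<Sum>k<n. 2 * p + 1)"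
      by (intro sum.cong refl) (simp only: card_nbrs_leaf sum_nbrs_leaf lessThan_iff mult_1)
    ultimately show ?thesis
      by (simp only: sum_core sum_leaves card_nbrs_rotations sum_nbrs_rotations sum_constant
          card_lessThan of_nat_id simp_thms mult_2)
  qed
  finally show ?thesis .
qed

end

theorem theorem3p4:
  fixes p n :: nat
  assumes "prime p" and "n = p ^ 2"
  shows "real (second_zagreb_index (intersection_graph (dihedral_group n)))
    = 2 * real p ^ 4 + 6 * real p ^ 3 + 13 / 2 * real p ^ 2 + 7 / 2 * real p + 1"
proof -
  have p: "p > 1" using assms(1) by (rule prime_gt_1_nat)
  then have "n > 0" by (simp add: assms(2))
  interpret dihedral_coords "dihedral_group n" n "\<lambda>i b. word_class (dihedral_rels n) (normal_word i b)"
    by (rule dihedral_coords_dihedral_group) fact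
  interpret dihedral_coords_prime_square "dihedral_group n" n
    "\<lambda>i b. word_class (dihedral_rels n) (normal_word i b)" p
    by unfold_locales (use assms in auto)
  \<comment> \<open>Passing to the reals makes halving exact; the truncated \<open>p - 1\<close>
    becomes a true difference since \<open>p > 1\<close>.\<close>
  have "2 * real (second_zagreb_index (intersection_graph (dihedral_group n))) =
    2 * ((real p + 1) * ((real p + 1) + real p * (2 * real p + 1))) +
    real p * ((2 * real p + 1) * (2 * (real p + 1) + (real p - 1) * (2 * real p + 1) + real p)) +
    real p ^ 2 * (2 * real p + 1)"
    using arg_cong[OF twice_second_zagreb_index, of real] of_nat_diff[of 1 p, where 'a = real] p
    by (simp only: assms(2) of_nat_add of_nat_mult of_nat_power of_nat_1 of_nat_numeral less_imp_le)
  then show ?thesis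
    by (simp add: power2_eq_square power3_eq_cube power4_eq_xxxx algebra_simps)
qed

end
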